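(* Let $\mathcal{H}$ be a real Hilbert space and let $A:\mathcal{H}\to2^{\mathcal{H}}$ be maximally monotone with $\operatorname{zer}A\neq\varnothing$. Let $x_0\in\mathcal{H}$, and for every $k\in\mathbb{N}$ let $\lambda_k\in[0,2]$, $c_k\in(0,\infty)$, $\eta_k\in[0,\infty)$ and $e_k\in\mathcal{H}$. Define $$(\forall k\in\mathbb{N})\quad x_{k+1}=(1-\lambda_k)x_k+\lambda_kJ_{c_kA}x_k+\eta_ke_k .$$ Suppose that $\sum_{k\in\mathbb{N}}\eta_k\|e_k\|<\infty$ and that one of the following assumptions holds: (A1) $\sum_{k\in\mathbb{N}}c_k^2=\infty$ and $\lambda_k=1$ for every $k\in\mathbb{N}$; (A2) $\sum_{k\in\mathbb{N}}\lambda_k(2-\lambda_k)=\infty$, $\sup_{k\in\mathbb{N}}c_k<\infty$, and for every $k\in\mathbb{N}$, $\lambda_k\in(0,2]$ and $c_{k+1}\ge c_k$. Then $(x_k)_{k\in\mathbb{N}}$ converges weakly to a point in $\operatorname{zer}A$.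
   Context: $\mathbb{N}=\{0,1,2,\ldots\}$. A set-valued operator $A:\mathcal{H}\to2^{\mathcal{H}}$ is monotone if $\langle x-y,u-v\rangle\ge0$ whenever $u\in Ax$, $v\in Ay$, and maximally monotone if no monotone operator has a graph properly containing that of $A$. $\operatorname{zer}A=\{x\in\mathcal{H}:0\in Ax\}$. For $c>0$, $J_{cA}=(\operatorname{Id}+cA)^{-1}$ is the resolvent, which for maximally monotone $A$ is single-valued and defined on all of $\mathcal{H}$. *)

theory Defs
  imports "HOL-Analysis.Analysis"
begin

text \<open>
  A set-valued operator on a real Hilbert space is a function of type \<open>'a \<Rightarrow> 'a set\<close>, where
  \<open>'a\<close> has sort \<open>{real_inner, banach}\<close>: a complete real inner product space of arbitrary dimension.
\<close>

definition op_graph :: "('a \<Rightarrow> 'b set) \<Rightarrow> ('a \<times> 'b) set"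
  where "op_graph A = {(x, u). u \<in> A x}"

definition op_inverse :: "('a \<Rightarrow> 'b set) \<Rightarrow> 'b \<Rightarrow> 'a set"
  where "op_inverse A u = {x. u \<in> A x}"

definition op_zeros :: "('a \<Rightarrow> 'b::zero set) \<Rightarrow> 'a set"
  where "op_zeros A = {x. 0 \<in> A x}"

definition monotone_operator :: "('a::real_inner \<Rightarrow> 'a set) \<Rightarrow> bool"
  where "monotone_operator A \<longleftrightarrow>
    (\<forall>x y. \<forall>u\<in>A x. \<forall>v\<in>A y. 0 \<le> (x - y) \<bullet> (u - v))"

definition maximally_monotone :: "('a::real_inner \<Rightarrow> 'a set) \<Rightarrow> bool"
  where "maximally_monotone A \<longleftrightarrow>
    monotone_operator A \<and> \<not> (\<exists>B. monotone_operator B \<and> op_graph A \<subset> op_graph B)"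

definition op_scale :: "real \<Rightarrow> ('a \<Rightarrow> 'b::real_vector set) \<Rightarrow> 'a \<Rightarrow> 'b set"
  where "op_scale c A x = (\<lambda>u. c *\<^sub>R u) ` A x"

definition id_plus_op :: "('a::ab_group_add \<Rightarrow> 'a set) \<Rightarrow> 'a \<Rightarrow> 'a set"
  where "id_plus_op A x = (\<lambda>u. x + u) ` A x"

text \<open>
  The resolvent \<open>(Id + A)\<^sup>-\<^sup>1\<close> is set-valued in general. When \<open>A\<close> is maximally monotone it has
  exactly one value at every point (Minty), and \<open>resolvent A x\<close> is that value; for other
  operators the description may be unspecified.
\<close>

definition resolvent :: "('a::ab_group_add \<Rightarrow> 'a set) \<Rightarrow> 'a \<Rightarrow> 'a"
  where "resolvent A x = (THE p. p \<in> op_inverse (id_plus_op A) x)"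

definition converges_weakly :: "(nat \<Rightarrow> 'a::real_inner) \<Rightarrow> 'a \<Rightarrow> bool"
  where "converges_weakly x p \<longleftrightarrow> (\<forall>y. (\<lambda>k. x k \<bullet> y) \<longlonglongrightarrow> p \<bullet> y)"

end

theory Submission
  imports Defs
begin

text \<open>
  The errors can be removed first. Each step of the error-free iteration applies a relaxed resolvent,
  a nonexpansive map, so starting the error-free iteration at \<open>x n\<close> from time \<open>n\<close> on
  gives a sequence that stays within the tail \<open>r n\<close> of the error series from the perturbed one.
  If all error-free sequences converge weakly to zeros of \<open>A\<close>, their limits \<open>z n\<close> satisfy
  \<open>norm (z m - z n) \<le> r n\<close> for \<open>n \<le> m\<close>, so they converge in norm to a zero \<open>p\<close>, and
  \<open>p\<close> is the weak limit of the perturbed sequence (\<open>perturbed_orbit_converges_weakly\<close>). This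
  detour matters when the \<open>c k\<close> can be small: an error then changes the residual
  \<open>u k = (x k - J (x k)) / c k\<close>, where \<open>J\<close> is the resolvent of step \<open>k\<close>, by an
  amount of size \<open>eta k * norm (e k) / c k\<close>, which need not be summable.

  Without errors, each step lowers the squared distance to every zero by at least
  \<open>lam k * (2 - lam k) * (c k * norm (u k))\<^sup>2\<close>, so these terms are summable. Monotonicity,
  applied to two successive points of the graph, shows that \<open>norm (u k)\<close> never increases
  (\<open>relaxed_resolvent_residual_antimono\<close>). Together with the divergent series in either
  alternative this forces \<open>u k\<close> to tend to \<open>0\<close> in norm. So does \<open>c k *\<^sub>R u k\<close>: for
  \<open>lam k = 1\<close> its squared norms are summable, and otherwise \<open>c\<close> is bounded. Since
  \<open>u k\<close> lies in the image under \<open>A\<close> of a point at distance \<open>c k * norm (u k)\<close> from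
  \<open>x k\<close>, asymptotic cluster points of \<open>x\<close> are zeros of \<open>A\<close>, and Opial's argument finishes
  the proof (\<open>exact_iteration_converges_weakly\<close>).

  Two classical ingredients are proved by elementary completeness arguments. Minty's theorem, that
  resolvents are defined everywhere, is obtained by maximizing a concave quadratic over a convex
  hull attached to the graph (\<open>Minty_graph\<close>). Weak sequential compactness is
  replaced by the observation that the closed convex hulls of the tails of a bounded sequence
  have a common point (\<open>tail_core_nonempty\<close>): closed half-spaces that
  contain a tail contain such a point, and this is all that the argument needs from a weak cluster point.
\<close>

section \<open>Cauchy criterion by squared distances\<close>

text \<open>
  Both optimization arguments below bound the squared distance of two near-optimal points by their
  optimality gap, which gives estimates of exactly this form.
\<close>

lemma convergent_if_dist_square_le:
  fixes a :: "nat \<Rightarrow> 'a::{real_inner, banach}"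
  assumes le: "\<And>m n. n \<le> m \<Longrightarrow> (norm (a m - a n))\<^sup>2 \<le> d n"
    and d: "d \<longlonglongrightarrow> 0"
  obtains l where "a \<longlonglongrightarrow> l"
proof -
  have "Cauchy a"
  proof (rule metric_CauchyI)
    fix e :: real assume e: "0 < e"
    have "eventually (\<lambda>n. d n < (e/2)\<^sup>2) sequentially"
      using d e by (intro order_tendstoD(2)[OF d]) auto
    then obtain N where N: "d N < (e/2)\<^sup>2"
      by (auto simp: eventually_sequentially)
    have close: "norm (a m - a N) < e/2" if "N \<le> m" for m
    proof (rule power_less_imp_less_base)
      show "(norm (a m - a N))\<^sup>2 < (e/2)\<^sup>2" using le[OF that] N by simp
    qed (use e in simp)
    show "\<exists>M. \<forall>m\<ge>M. \<forall>n\<ge>M. dist (a m) (a n) < e"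
    proof (intro exI allI impI)
      fix m n assume "N \<le> m" "N \<le> n"
      then show "dist (a m) (a n) < e"
        using close[of m] close[of n] by (intro dist_triangle_half_l[of "a m" "a N" e "a n"]) (simp_all add: dist_norm)
    qed
  qed
  then obtain l where "a \<longlonglongrightarrow> l" by (auto simp: Cauchy_convergent_iff convergent_def)
  then show thesis by (rule that)
qed

lemma parallelogram_midpoint:
  fixes a b :: "'a::real_inner"
  shows "(norm (a - b))\<^sup>2 = 2 * (norm a)\<^sup>2 + 2 * (norm b)\<^sup>2 - 4 * (norm ((1/2) *\<^sub>R a + (1/2) *\<^sub>R b))\<^sup>2"
  by (simp add: power2_norm_eq_inner algebra_simps inner_commute)

section \<open>Minty's theorem\<close>

text \<open>
  Monotonicity of the graph is the statement that
  \<open>r + r' - y \<bullet> z' - y' \<bullet> z \<le> 0\<close> for any two generators. The left side is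
  affine in each of the two triples separately, so the inequality passes to the hull in one argument
  and then in the other; the claim is its diagonal case.
\<close>

lemma convex_hull_bilinear_le:
  fixes G :: "('a::real_inner \<times> 'a) set"
  defines "D \<equiv> convex hull ((\<lambda>(y, z). (y, z, y \<bullet> z)) ` G)"
  assumes mono: "\<And>y z y' z'. (y, z) \<in> G \<Longrightarrow> (y', z') \<in> G \<Longrightarrow> (y - y') \<bullet> (z - z') \<le> 0"
    and mem: "(y, z, r) \<in> D"
  shows "r \<le> y \<bullet> z"
proof -
  let ?S = "\<lambda>y' z' r'. {(y, z, r). r + r' - y \<bullet> z' - y' \<bullet> z \<le> 0}"
  have conv: "convex (?S y' z' r')" for y' z' :: 'a and r' :: real
  proof -
    have eq: "?S y' z' r' = {v. inner (z', y', -1) v \<ge> r'}"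
      by (auto simp: inner_commute)
    show ?thesis unfolding eq by (rule convex_halfspace_ge)
  qed
  have gen: "D \<subseteq> ?S y' z' (y' \<bullet> z')" if "(y', z') \<in> G" for y' z'
    unfolding D_def using mono[OF _ that]
    by (intro hull_minimal conv) (force simp: inner_diff inner_commute)
  have sym: "(y1, z1, r1) \<in> ?S y2 z2 r2 \<Longrightarrow> (y2, z2, r2) \<in> ?S y1 z1 r1" for y1 z1 y2 z2 :: 'a and r1 r2
    by (auto simp: inner_commute)
  have "D \<subseteq> ?S y z r"
    unfolding D_def
  proof (intro hull_minimal conv subsetI)
    fix v assume "v \<in> (\<lambda>(y, z). (y, z, y \<bullet> z)) ` G"
    then obtain y' z' where v: "v = (y', z', y' \<bullet> z')" and "(y', z') \<in> G" by auto
    then have "(y, z, r) \<in> ?S y' z' (y' \<bullet> z')" using gen mem by blast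
    then show "v \<in> ?S y z r" unfolding v by (rule sym)
  qed
  then show ?thesis using mem by auto
qed

text \<open>
  The condition on \<open>p\<close> for one pair says, with \<open>w = (y + z - v) / 2\<close> and
  \<open>s = y \<bullet> (z - v)\<close>, that \<open>s - 2 * (p \<bullet> w) + (norm p)\<^sup>2 \<le> 0\<close>. Maximize
  \<open>h = s - (norm w)\<^sup>2\<close> over the convex hull of all these data. Since \<open>h\<close> is uniformly
  concave in \<open>w\<close>, the \<open>w\<close>-parts of a maximizing sequence converge, to \<open>p\<close> say. The
  first-order condition at the maximum, in the direction of the given pair, bounds
  \<open>s - 2 * (p \<bullet> w) + (norm p)\<^sup>2\<close> by the maximal value, and that is nonpositive by
  \<open>convex_hull_bilinear_le\<close>.
\<close>

lemma Minty_graph: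
  fixes G :: "('a::{real_inner, banach} \<times> 'a) set"
  assumes mono: "\<And>y v y' v'. (y, v) \<in> G \<Longrightarrow> (y', v') \<in> G \<Longrightarrow> 0 \<le> (y - y') \<bullet> (v - v')"
  obtains p where "\<And>y v. (y, v) \<in> G \<Longrightarrow> 0 \<le> (p - y) \<bullet> ((z - p) - v)"
proof (cases "G = {}")
  case True
  then show thesis using that by blast
next
  case False
  define G' where "G' = (\<lambda>(y, v). (y, z - v)) ` G"
  define D where "D = convex hull ((\<lambda>(y, z). (y, z, y \<bullet> z)) ` G')"
  define w :: "'a \<times> 'a \<times> real \<Rightarrow> 'a" where "w = (\<lambda>(y, z, r). (1/2) *\<^sub>R (y + z))"
  define s :: "'a \<times> 'a \<times> real \<Rightarrow> real" where "s = (\<lambda>(y, z, r). r)"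
  define h where "h v = s v - (norm (w v))\<^sup>2" for v
  have w_lin: "w (a *\<^sub>R u + b *\<^sub>R v) = a *\<^sub>R w u + b *\<^sub>R w v" for a b u v
    by (simp add: w_def case_prod_beta algebra_simps)
  have s_lin: "s (a *\<^sub>R u + b *\<^sub>R v) = a * s u + b * s v" for a b u v
    by (simp add: s_def case_prod_beta)
  have convD: "convex D" by (simp add: D_def)
  have h_le0: "h v \<le> 0" if "v \<in> D" for v
  proof -
    obtain y z' r where v: "v = (y, z', r)" by (cases v)
    have "r \<le> y \<bullet> z'"
    proof (rule convex_hull_bilinear_le)
      show "(y, z', r) \<in> convex hull ((\<lambda>(y, z). (y, z, y \<bullet> z)) ` G')" 
        using that v by (simp add: D_def)
      show "(a - b) \<bullet> (c - d) \<le> 0" if "(a, c) \<in> G'" "(b, d) \<in> G'" for a b c d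
        using that mono unfolding G'_def by (force simp: algebra_simps)
    qed
    moreover have "(norm (w v))\<^sup>2 = y \<bullet> z' + (norm ((1/2) *\<^sub>R (y - z')))\<^sup>2"
      by (simp add: v w_def power2_norm_eq_inner algebra_simps inner_commute)
    moreover have "h v = r - (norm (w v))\<^sup>2" by (simp add: h_def s_def v)
    ultimately show ?thesis
      using zero_le_power2[of "norm ((1/2) *\<^sub>R (y - z'))"] by linarith
  qed
  define M where "M = Sup (h ` D)"
  have bdd: "bdd_above (h ` D)" by (rule bdd_aboveI2[OF h_le0])
  have ne: "D \<noteq> {}" using False by (simp add: D_def G'_def)
  have le_M: "h v \<le> M" if "v \<in> D" for v
    unfolding M_def using that bdd by (intro cSup_upper) auto
  have M_le0: "M \<le> 0" unfolding M_def using ne h_le0 by (intro cSup_least) auto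
  define eps :: "nat \<Rightarrow> real" where "eps n = inverse (real (Suc n))" for n
  have eps: "0 < eps n" "n \<le> m \<Longrightarrow> eps m \<le> eps n" for m n
    by (simp_all add: eps_def)
  have lim0: "eps \<longlonglongrightarrow> 0"
    unfolding eps_def by (rule LIMSEQ_inverse_real_of_nat)
  have "\<exists>v\<in>D. M - eps n < h v" for n
    using less_cSupD[of "h ` D" "M - eps n"] ne eps(1) by (auto simp: M_def)
  then obtain v where vD: "\<And>n. v n \<in> D" and vM: "\<And>n. M - eps n < h (v n)" by metis
  have h_lim: "(\<lambda>n. h (v n)) \<longlonglongrightarrow> M"
  proof (rule tendsto_sandwich[OF _ _ _ tendsto_const])
    show "(\<lambda>n. M - eps n) \<longlonglongrightarrow> M" using tendsto_diff[OF tendsto_const lim0, of M] by simp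
  qed (use vM vD le_M in \<open>auto intro!: always_eventually less_imp_le\<close>)
  obtain p where p: "(\<lambda>n. w (v n)) \<longlonglongrightarrow> p"
  proof (rule convergent_if_dist_square_le)
    show "(\<lambda>n. 4 * eps n) \<longlonglongrightarrow> 0" using tendsto_mult_right_zero[OF lim0] by simp
    fix m n :: nat assume mn: "n \<le> m"
    have "(1/2) *\<^sub>R v m + (1/2) *\<^sub>R v n \<in> D"
      using convexD[OF convD vD vD, of "1/2" "1/2"] by simp
    then have "h ((1/2) *\<^sub>R v m + (1/2) *\<^sub>R v n) \<le> M" by (rule le_M)
    moreover have "eps m \<le> eps n" using mn by (rule eps(2))
    ultimately show "(norm (w (v m) - w (v n)))\<^sup>2 \<le> 4 * eps n"
      using vM[of m] vM[of n] parallelogram_midpoint[of "w (v m)" "w (v n)"]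
      by (simp add: h_def w_lin s_lin)
  qed
  have s_lim: "(\<lambda>n. s (v n)) \<longlonglongrightarrow> M + (norm p)\<^sup>2"
    using tendsto_add[OF h_lim tendsto_power[OF tendsto_norm[OF p], of 2]] by (simp add: h_def)
  have "0 \<le> (p - y) \<bullet> ((z - p) - u)" if yu: "(y, u) \<in> G" for y u
  proof -
    define g where "g = (y, z - u, y \<bullet> (z - u))"
    have gD: "g \<in> D" unfolding D_def G'_def g_def using yu by (intro hull_inc) force
    \<comment> \<open>Optimality along the segment towards \<open>g\<close>, divided by its parameter \<open>t\<close>.\<close>
    have step: "s g + (norm p)\<^sup>2 - 2 * (p \<bullet> w g) \<le> M + t * (norm (w g - p))\<^sup>2" if t: "0 < t" "t < 1" for t
    proof -
      have "(\<lambda>n. h ((1 - t) *\<^sub>R v n + t *\<^sub>R g)) \<longlonglongrightarrow>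
          (1 - t) * (M + (norm p)\<^sup>2) + t * s g - (norm ((1 - t) *\<^sub>R p + t *\<^sub>R w g))\<^sup>2"
        unfolding h_def w_lin s_lin by (intro tendsto_intros s_lim p)
      moreover have "h ((1 - t) *\<^sub>R v n + t *\<^sub>R g) \<le> M" for n
        using t by (intro le_M convexD[OF convD vD gD]) auto
      ultimately have "(1 - t) * (M + (norm p)\<^sup>2) + t * s g - (norm ((1 - t) *\<^sub>R p + t *\<^sub>R w g))\<^sup>2 \<le> M"
        by (intro LIMSEQ_le_const2) auto
      moreover have "(norm ((1 - t) *\<^sub>R p + t *\<^sub>R w g))\<^sup>2
          = (norm p)\<^sup>2 + 2 * t * (p \<bullet> w g - (norm p)\<^sup>2) + t * (t * (norm (w g - p))\<^sup>2)"
        by (simp add: power2_norm_eq_inner algebra_simps inner_commute)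
      ultimately have "t * (s g + (norm p)\<^sup>2 - 2 * (p \<bullet> w g)) \<le> t * (M + t * (norm (w g - p))\<^sup>2)"
        by (simp add: algebra_simps)
      then show ?thesis using t by simp
    qed
    have "((\<lambda>t. M + t * (norm (w g - p))\<^sup>2) \<longlongrightarrow> M + 0 * (norm (w g - p))\<^sup>2) (at_right 0)"
      by (intro tendsto_intros)
    then have "s g + (norm p)\<^sup>2 - 2 * (p \<bullet> w g) \<le> M + 0 * (norm (w g - p))\<^sup>2"
      by (rule tendsto_lowerbound)
        (use step in \<open>auto simp: eventually_at_right_field intro!: exI[of _ 1]\<close>)
    then have "s g + (norm p)\<^sup>2 - 2 * (p \<bullet> w g) \<le> 0" using M_le0 by simp
    then show ?thesis
      by (simp add: g_def s_def w_def power2_norm_eq_inner algebra_simps inner_commute)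
  qed
  then show thesis using that by blast
qed

section \<open>Resolvents of maximally monotone operators\<close>

text \<open>
  Maximality is used only through this: otherwise \<open>(x, u)\<close> could be added to the graph.
\<close>

lemma maximally_monotone_mem:
  assumes max: "maximally_monotone A"
    and rel: "\<And>y v. v \<in> A y \<Longrightarrow> 0 \<le> (x - y) \<bullet> (u - v)"
  shows "u \<in> A x"
proof (rule ccontr)
  assume nin: "u \<notin> A x"
  define B where "B = A(x := insert u (A x))"
  have mono: "monotone_operator A" using max by (simp add: maximally_monotone_def)
  have rel': "0 \<le> (y - x) \<bullet> (v - u)" if "v \<in> A y" for y v
    using rel[OF that] by (simp add: algebra_simps)
  have "monotone_operator B"
    using mono rel rel' unfolding monotone_operator_def B_def by (auto split: if_splits)
  moreover have "op_graph A \<subset> op_graph B"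
    using nin unfolding op_graph_def B_def by auto
  ultimately show False using max by (auto simp: maximally_monotone_def)
qed

text \<open>
  Existence comes from Minty's theorem for the scaled graph, uniqueness from monotonicity; hence the
  definite description in \<open>resolvent\<close> denotes the expected point.
\<close>

lemma resolvent_op_scale_mem:
  fixes A :: "'a::{real_inner, banach} \<Rightarrow> 'a set"
  assumes max: "maximally_monotone A" and c: "0 < c"
  shows "(1/c) *\<^sub>R (x - resolvent (op_scale c A) x) \<in> A (resolvent (op_scale c A) x)"
proof -
  have mono: "0 \<le> (y - y') \<bullet> (v - v')" if "v \<in> A y" "v' \<in> A y'" for y y' v v'
    using max that by (auto simp: maximally_monotone_def monotone_operator_def)
  have iff: "p \<in> op_inverse (id_plus_op (op_scale c A)) x \<longleftrightarrow> (1/c) *\<^sub>R (x - p) \<in> A p" (is "?L \<longleftrightarrow> ?R") for p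
  proof
    assume ?L then show ?R using c by (auto simp: op_inverse_def id_plus_op_def op_scale_def)
  next
    assume ?R
    moreover have "x = p + c *\<^sub>R ((1/c) *\<^sub>R (x - p))" using c by simp
    ultimately show ?L unfolding op_inverse_def id_plus_op_def op_scale_def by blast
  qed
  obtain p where p: "\<And>y v. (y, v) \<in> (\<lambda>(y, v). (y, c *\<^sub>R v)) ` op_graph A \<Longrightarrow> 0 \<le> (p - y) \<bullet> ((x - p) - v)"
  proof (rule Minty_graph[where z = x])
    fix y v y' v'
    assume "(y, v) \<in> (\<lambda>(y, v). (y, c *\<^sub>R v)) ` op_graph A"
      and "(y', v') \<in> (\<lambda>(y, v). (y, c *\<^sub>R v)) ` op_graph A"
    then obtain a b where "a \<in> A y" "b \<in> A y'" "v = c *\<^sub>R a" "v' = c *\<^sub>R b"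
      by (auto simp: op_graph_def)
    moreover from this have "0 \<le> c * ((y - y') \<bullet> (a - b))" using mono c by simp
    ultimately show "0 \<le> (y - y') \<bullet> (v - v')" by (simp add: inner_diff_right right_diff_distrib)
  qed blast
  have ex: "(1/c) *\<^sub>R (x - p) \<in> A p"
  proof (rule maximally_monotone_mem[OF max])
    fix y v assume "v \<in> A y"
    then have "0 \<le> (p - y) \<bullet> ((x - p) - c *\<^sub>R v)" by (intro p) (force simp: op_graph_def)
    also have "(x - p) - c *\<^sub>R v = c *\<^sub>R ((1/c) *\<^sub>R (x - p) - v)" using c by (simp add: algebra_simps)
    finally show "0 \<le> (p - y) \<bullet> ((1/c) *\<^sub>R (x - p) - v)" using c by (simp add: zero_le_mult_iff)
  qed
  have unique: "q = p" if "(1/c) *\<^sub>R (x - q) \<in> A q" for q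
  proof -
    have "0 \<le> (q - p) \<bullet> ((1/c) *\<^sub>R (x - q) - (1/c) *\<^sub>R (x - p))" by (rule mono[OF that ex])
    also have "(1/c) *\<^sub>R (x - q) - (1/c) *\<^sub>R (x - p) = -((1/c) *\<^sub>R (q - p))" by (simp add: algebra_simps)
    finally have "(norm (q - p))\<^sup>2 / c \<le> 0" by (simp add: power2_norm_eq_inner)
    then show ?thesis using c by (simp add: divide_le_0_iff)
  qed
  have "resolvent (op_scale c A) x = p"
    unfolding resolvent_def iff using ex unique by (rule the_equality)
  then show ?thesis using ex by simp
qed

definition relaxed_resolvent :: "('a::real_vector \<Rightarrow> 'a set) \<Rightarrow> real \<Rightarrow> real \<Rightarrow> 'a \<Rightarrow> 'a"
  where "relaxed_resolvent A l c x = (1 - l) *\<^sub>R x + l *\<^sub>R resolvent (op_scale c A) x"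

text \<open>
  With \<open>a = x - y\<close> and \<open>b\<close> the difference of the resolvents this gives nonexpansiveness of
  relaxed resolvents; with \<open>y\<close> a zero, it gives the decrease of the distance to that zero.
\<close>

lemma relaxation_norm_le:
  fixes a b :: "'a::real_inner"
  assumes "0 \<le> b \<bullet> (a - b)" "0 \<le> l"
  shows "(norm ((1 - l) *\<^sub>R a + l *\<^sub>R b))\<^sup>2 \<le> (norm a)\<^sup>2 - l * (2 - l) * (norm (a - b))\<^sup>2"
proof -
  have expand: "(norm (a - l *\<^sub>R d))\<^sup>2
      = (norm a)\<^sup>2 - l * (2 - l) * (norm d)\<^sup>2 - 2 * (l * ((a - d) \<bullet> d))" for d
    unfolding power2_norm_eq_inner
    by (simp add: inner_diff_left inner_diff_right inner_commute[of d a] left_diff_distrib right_diff_distrib)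
  have "(1 - l) *\<^sub>R a + l *\<^sub>R b = a - l *\<^sub>R (a - b)" by (simp add: algebra_simps)
  then have "(norm ((1 - l) *\<^sub>R a + l *\<^sub>R b))\<^sup>2
      = (norm a)\<^sup>2 - l * (2 - l) * (norm (a - b))\<^sup>2 - 2 * (l * (b \<bullet> (a - b)))"
    using expand[of "a - b"] by simp
  moreover have "0 \<le> l * (b \<bullet> (a - b))" using assms by simp
  ultimately show ?thesis by linarith
qed

lemma relaxed_resolvent_nonexpansive:
  fixes A :: "'a::{real_inner, banach} \<Rightarrow> 'a set"
  assumes max: "maximally_monotone A" and c: "0 < c" and l: "0 \<le> l" "l \<le> 2"
  shows "norm (relaxed_resolvent A l c x - relaxed_resolvent A l c y) \<le> norm (x - y)"
proof -
  let ?J = "resolvent (op_scale c A)"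
  have "0 \<le> (?J x - ?J y) \<bullet> ((1/c) *\<^sub>R (x - ?J x) - (1/c) *\<^sub>R (y - ?J y))"
    using max resolvent_op_scale_mem[OF max c, of x] resolvent_op_scale_mem[OF max c, of y]
    by (auto simp: maximally_monotone_def monotone_operator_def)
  also have "(1/c) *\<^sub>R (x - ?J x) - (1/c) *\<^sub>R (y - ?J y) = (1/c) *\<^sub>R ((x - y) - (?J x - ?J y))"
    by (simp add: algebra_simps)
  finally have "0 \<le> (?J x - ?J y) \<bullet> ((x - y) - (?J x - ?J y))" using c by (simp add: zero_le_divide_iff)
  from relaxation_norm_le[OF this l(1)]
  have "(norm (relaxed_resolvent A l c x - relaxed_resolvent A l c y))\<^sup>2
      \<le> (norm (x - y))\<^sup>2 - l * (2 - l) * (norm ((x - y) - (?J x - ?J y)))\<^sup>2"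
    by (simp add: relaxed_resolvent_def algebra_simps)
  moreover have "0 \<le> l * (2 - l) * (norm ((x - y) - (?J x - ?J y)))\<^sup>2" using l by simp
  ultimately have "(norm (relaxed_resolvent A l c x - relaxed_resolvent A l c y))\<^sup>2 \<le> (norm (x - y))\<^sup>2"
    by linarith
  then show ?thesis by (rule power2_le_imp_le) simp
qed

section \<open>Weak convergence without weak compactness\<close>

text \<open>
  Every weak cluster point of \<open>x\<close> lies in this set. Its elements replace weak cluster points:
  they inherit every linear inequality that holds for almost all terms of the sequence.
\<close>

definition tail_core :: "(nat \<Rightarrow> 'a::real_normed_vector) \<Rightarrow> 'a set"
  where "tail_core x = (\<Inter>n. closure (convex hull (x ` {n..})))"

lemma tail_core_ge:
  assumes q: "q \<in> tail_core x" and ev: "eventually (\<lambda>k. b \<le> x k \<bullet> y) sequentially"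
  shows "b \<le> q \<bullet> y"
proof -
  obtain n where n: "\<And>k. n \<le> k \<Longrightarrow> b \<le> x k \<bullet> y" using ev by (auto simp: eventually_sequentially)
  have "closure (convex hull (x ` {n..})) \<subseteq> {v. b \<le> y \<bullet> v}"
    using n by (intro closure_minimal hull_minimal closed_halfspace_ge convex_halfspace_ge)
      (auto simp: inner_commute)
  then show ?thesis using q by (auto simp: tail_core_def inner_commute)
qed

lemma tail_core_le:
  assumes q: "q \<in> tail_core x" and ev: "eventually (\<lambda>k. x k \<bullet> y \<le> b) sequentially"
  shows "q \<bullet> y \<le> b"
  using tail_core_ge[OF q, of "-b" "-y"] ev by simp

lemma tail_core_tendsto:
  assumes q: "q \<in> tail_core x" and lim: "(\<lambda>k. x k \<bullet> y) \<longlonglongrightarrow> l"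
  shows "q \<bullet> y = l"
proof (rule antisym; rule field_le_epsilon)
  fix e :: real assume e: "0 < e"
  show "q \<bullet> y \<le> l + e"
    by (rule tail_core_le[OF q]) (use order_tendstoD(2)[OF lim, of "l + e"] e in \<open>auto elim: eventually_mono\<close>)
  have "l - e \<le> q \<bullet> y"
    by (rule tail_core_ge[OF q]) (use order_tendstoD(1)[OF lim, of "l - e"] e in \<open>auto elim: eventually_mono\<close>)
  then show "l \<le> q \<bullet> y + e" by simp
qed

lemma tail_core_subseq:
  assumes "strict_mono r"
  shows "tail_core (x \<circ> r) \<subseteq> tail_core x"
proof -
  have "(x \<circ> r) ` {n..} \<subseteq> x ` {n..}" for n
    using strict_mono_imp_increasing[OF assms] by (auto intro: order_trans)
  then show ?thesis unfolding tail_core_def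
    by (intro INF_mono' closure_mono hull_mono) auto
qed

text \<open>
  The least norms in the sets \<open>K n\<close> increase to a finite limit. A point of \<open>K n\<close> and a point of
  a smaller \<open>K m\<close>, both of almost least norm, have their midpoint in \<open>K n\<close>, so by the
  parallelogram law they are close together. Almost-minimal points therefore converge, to a point of all
  the sets.
\<close>

lemma decreasing_closed_convex_Inter_nonempty:
  fixes K :: "nat \<Rightarrow> 'a::{real_inner, banach} set"
  assumes dec: "\<And>m n. n \<le> m \<Longrightarrow> K m \<subseteq> K n"
    and closed: "\<And>n. closed (K n)" and conv: "\<And>n. convex (K n)" and ne: "\<And>n. K n \<noteq> {}"
    and bdd: "bounded (K 0)"
  shows "(\<Inter>n. K n) \<noteq> {}"
proof -
  define d where "d n = Inf ((\<lambda>v. (norm v)\<^sup>2) ` K n)" for n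
  have bb: "bdd_below ((\<lambda>v. (norm v)\<^sup>2) ` K n)" for n by (rule bdd_belowI[of _ 0]) auto
  have d_le: "d n \<le> (norm v)\<^sup>2" if "v \<in> K n" for n v
    unfolding d_def using that bb by (intro cInf_lower) auto
  have d_mono: "d n \<le> d m" if "n \<le> m" for n m
    unfolding d_def using dec[OF that] ne bb by (intro cInf_superset_mono) auto
  obtain B where B: "\<And>v. v \<in> K 0 \<Longrightarrow> norm v \<le> B" using bdd by (auto simp: bounded_iff)
  have "d n \<le> B\<^sup>2" for n
  proof -
    obtain v where v: "v \<in> K n" using ne by blast
    then have "norm v \<le> B" using B dec[of 0 n] by auto
    then show ?thesis using d_le[OF v] by (meson norm_ge_zero order_trans power_mono)
  qed
  then obtain L where L: "d \<longlonglongrightarrow> L" "\<And>n. d n \<le> L"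
    using incseq_convergent[of d "B\<^sup>2"] d_mono by (auto simp: incseq_def)
  define eps :: "nat \<Rightarrow> real" where "eps n = inverse (real (Suc n))" for n
  have eps: "0 < eps n" "n \<le> m \<Longrightarrow> eps m \<le> eps n" for m n
    by (simp_all add: eps_def)
  have lim0: "eps \<longlonglongrightarrow> 0"
    unfolding eps_def by (rule LIMSEQ_inverse_real_of_nat)
  have "\<exists>v\<in>K n. (norm v)\<^sup>2 < d n + eps n" for n
    using cInf_lessD[of "(\<lambda>v. (norm v)\<^sup>2) ` K n" "d n + eps n"] ne[of n] eps(1)[of n] by (auto simp: d_def)
  then obtain a where aK: "\<And>n. a n \<in> K n" and a: "\<And>n. (norm (a n))\<^sup>2 < d n + eps n" by metis
  obtain l where l: "a \<longlonglongrightarrow> l"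
  proof (rule convergent_if_dist_square_le)
    have "(\<lambda>n. 2 * (L - d n) + 4 * eps n) \<longlonglongrightarrow> 2 * (L - L) + 4 * 0"
      by (intro tendsto_intros L lim0)
    then show "(\<lambda>n. 2 * (L - d n) + 4 * eps n) \<longlonglongrightarrow> 0" by simp
    fix m n :: nat assume mn: "n \<le> m"
    have "(1/2) *\<^sub>R a m + (1/2) *\<^sub>R a n \<in> K n"
      using convexD[OF conv, of "a m" n "a n" "1/2" "1/2"] aK[of n] aK[of m] dec[OF mn] by auto
    then have "d n \<le> (norm ((1/2) *\<^sub>R a m + (1/2) *\<^sub>R a n))\<^sup>2" by (rule d_le)
    moreover have "eps m \<le> eps n" using mn by (rule eps(2))
    ultimately show "(norm (a m - a n))\<^sup>2 \<le> 2 * (L - d n) + 4 * eps n"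
      using a[of m] a[of n] L(2)[of m] parallelogram_midpoint[of "a m" "a n"] by (smt (verit))
  qed
  have "l \<in> K n" for n
  proof (rule Lim_in_closed_set[OF closed _ _ l])
    show "eventually (\<lambda>m. a m \<in> K n) sequentially"
      using aK dec unfolding eventually_sequentially by blast
  qed simp
  then show ?thesis by blast
qed

lemma tail_core_nonempty:
  fixes x :: "nat \<Rightarrow> 'a::{real_inner, banach}"
  assumes "bounded (range x)"
  shows "tail_core x \<noteq> {}"
  unfolding tail_core_def
proof (rule decreasing_closed_convex_Inter_nonempty)
  show "bounded (closure (convex hull (x ` {0..})))"
    using assms by (simp add: bounded_closure bounded_convex_hull)
  show "closure (convex hull (x ` {m..})) \<subseteq> closure (convex hull (x ` {n..}))" if "n \<le> m" for m n
    using that by (intro closure_mono hull_mono) auto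
qed (auto simp: convex_closure)

text \<open>One-sided bounds suffice because \<open>y\<close> may be replaced by \<open>-y\<close>.\<close>

lemma converges_weaklyI:
  assumes "\<And>y e. 0 < e \<Longrightarrow> eventually (\<lambda>k. x k \<bullet> y < p \<bullet> y + e) sequentially"
  shows "converges_weakly x p"
  unfolding converges_weakly_def
proof (intro allI order_tendstoI)
  fix y b
  show "eventually (\<lambda>k. x k \<bullet> y < b) sequentially" if "p \<bullet> y < b"
    using assms[of "b - p \<bullet> y" y] that by simp
  show "eventually (\<lambda>k. b < x k \<bullet> y) sequentially" if "b < p \<bullet> y"
    using assms[of "p \<bullet> y - b" "-y"] that by simp
qed

text \<open>
  If the distances to \<open>p\<close> and to \<open>q\<close> both converge, then so does
  \<open>x k \<bullet> (p - q)\<close>, since it is a combination of the squared distances. When \<open>p\<close> and \<open>q\<close> lie in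
  \<open>tail_core x\<close>, both have this limit as inner product with \<open>p - q\<close>, which forces
  \<open>p = q\<close>. A subsequence staying away from \<open>p\<close> in some direction would have a point
  of its own \<open>tail_core\<close> different from \<open>p\<close>.
\<close>

lemma Opial_tail_core:
  fixes x :: "nat \<Rightarrow> 'a::{real_inner, banach}"
  assumes bdd: "bounded (range x)"
    and conv: "\<And>z. z \<in> C \<Longrightarrow> convergent (\<lambda>k. norm (x k - z))"
    and sub: "tail_core x \<subseteq> C"
  shows "\<exists>p\<in>C. converges_weakly x p"
proof -
  obtain p where p: "p \<in> tail_core x" using tail_core_nonempty[OF bdd] by blast
  have unique: "q = p" if q: "q \<in> tail_core (x \<circ> r)" and r: "strict_mono r" for q r
  proof -
    have qx: "q \<in> tail_core x" using q tail_core_subseq[OF r] by blast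
    obtain a b where a: "(\<lambda>k. norm (x k - q)) \<longlonglongrightarrow> a" and b: "(\<lambda>k. norm (x k - p)) \<longlonglongrightarrow> b"
      using conv[of p] conv[of q] p qx sub unfolding convergent_def by blast
    have "(\<lambda>k. (1/2) * ((norm (x k - q))\<^sup>2 - (norm (x k - p))\<^sup>2 + (norm p)\<^sup>2 - (norm q)\<^sup>2))
        \<longlonglongrightarrow> (1/2) * (a\<^sup>2 - b\<^sup>2 + (norm p)\<^sup>2 - (norm q)\<^sup>2)"
      by (intro tendsto_intros a b)
    moreover have "(1/2) * ((norm (x k - q))\<^sup>2 - (norm (x k - p))\<^sup>2 + (norm p)\<^sup>2 - (norm q)\<^sup>2) = x k \<bullet> (p - q)" for k
      by (simp add: power2_norm_eq_inner algebra_simps inner_commute)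
    ultimately obtain l where "(\<lambda>k. x k \<bullet> (p - q)) \<longlonglongrightarrow> l" by auto
    then have "p \<bullet> (p - q) = l" "q \<bullet> (p - q) = l" using tail_core_tendsto p qx by blast+
    then have "(p - q) \<bullet> (p - q) = 0" by (simp add: inner_diff_left)
    then show ?thesis by simp
  qed
  have "converges_weakly x p"
  proof (rule converges_weaklyI, rule ccontr)
    fix y and e :: real
    assume e: "0 < e" and "\<not> eventually (\<lambda>k. x k \<bullet> y < p \<bullet> y + e) sequentially"
    then have "infinite {k. p \<bullet> y + e \<le> x k \<bullet> y}"
      by (simp add: not_eventually frequently_cofinite not_less flip: cofinite_eq_sequentially)
    from infinite_enumerate[OF this] obtain r :: "nat \<Rightarrow> nat"
      where r: "strict_mono r" "\<And>k. p \<bullet> y + e \<le> x (r k) \<bullet> y" by auto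
    have "bounded (range (x \<circ> r))" using bdd by (rule bounded_subset) auto
    then obtain q where q: "q \<in> tail_core (x \<circ> r)" using tail_core_nonempty by blast
    have "p \<bullet> y + e \<le> q \<bullet> y" using tail_core_ge[OF q] r(2) by simp
    then show False using unique[OF q r(1)] e by simp
  qed
  then show ?thesis using p sub by blast
qed

section \<open>The error-free iteration\<close>

text \<open>
  A positive limit of \<open>a\<close> would be a lower bound for \<open>a\<close>, making the
  weighted sum of squares diverge with the weights.
\<close>

lemma antimono_tendsto_zero:
  fixes w a :: "nat \<Rightarrow> real"
  assumes div: "filterlim (\<lambda>n. \<Sum>k<n. w k) at_top sequentially"
    and w: "\<And>k. 0 \<le> w k" and a: "\<And>k. 0 \<le> a k" and dec: "\<And>k. a (Suc k) \<le> a k"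
    and bound: "\<And>n. (\<Sum>k<n. w k * (a k)\<^sup>2) \<le> B"
  shows "a \<longlonglongrightarrow> 0"
proof -
  have "decseq a" using dec by (rule decseq_SucI)
  then obtain L where L: "a \<longlonglongrightarrow> L" and La: "\<And>k. L \<le> a k"
    using decseq_convergent[of a 0] a by blast
  have L0: "0 \<le> L" using L a by (intro LIMSEQ_le_const) auto
  have "L = 0"
  proof (rule ccontr)
    assume "L \<noteq> 0"
    then have pos: "0 < L\<^sup>2" by simp
    obtain n where n: "B / L\<^sup>2 + 1 \<le> (\<Sum>k<n. w k)"
      using div by (auto simp: filterlim_at_top eventually_sequentially)
    have "(\<Sum>k<n. w k) * L\<^sup>2 \<le> (\<Sum>k<n. w k * (a k)\<^sup>2)"
      unfolding sum_distrib_right using La L0 w by (intro sum_mono mult_left_mono power_mono) auto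
    also have "\<dots> \<le> B" by (rule bound)
    finally have "(\<Sum>k<n. w k) \<le> B / L\<^sup>2" using pos by (simp add: field_simps)
    then show False using n by simp
  qed
  then show ?thesis using L by simp
qed

text \<open>
  Here \<open>u\<close> and \<open>u'\<close> are the residuals of two successive steps, and the first assumption is
  monotonicity between the two resolvent points, whose difference is expressed by the residuals.
  With \<open>m = (1 - l) * c\<close>, the Cauchy-Schwarz inequality turns it into
  \<open>(norm u' - norm u) * (c' * norm u' - m * norm u) \<le> 0\<close>. As \<open>\<bar>m\<bar> \<le> c'\<close>, the
  second factor would be positive if \<open>norm u'\<close> exceeded \<open>norm u\<close>.
\<close>

lemma relaxed_resolvent_residual_antimono:
  fixes u u' :: "'a::real_inner"
  assumes mono: "0 \<le> (((1 - l) * c) *\<^sub>R u - c' *\<^sub>R u') \<bullet> (u' - u)"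
    and c: "0 < c" "0 < c'" and l: "0 \<le> l" "l \<le> 2" and or: "l = 1 \<or> c \<le> c'"
  shows "norm u' \<le> norm u"
proof (rule ccontr)
  assume "\<not> norm u' \<le> norm u"
  then have less: "norm u < norm u'" by simp
  define m where "m = (1 - l) * c"
  have m: "\<bar>m\<bar> \<le> c'" "m \<le> c'"
  proof -
    have "\<bar>m\<bar> = \<bar>1 - l\<bar> * c" using c by (simp add: m_def abs_mult)
    also have "\<dots> \<le> c'"
    proof (cases "l = 1")
      case False
      have "\<bar>1 - l\<bar> * c \<le> 1 * c" using l c by (intro mult_right_mono) auto
      then show ?thesis using or False by simp
    qed (use c in simp)
    finally show "\<bar>m\<bar> \<le> c'" "m \<le> c'" by auto
  qed
  have "c' * (norm u')\<^sup>2 + m * (norm u)\<^sup>2 \<le> (m + c') * (u \<bullet> u')"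
    using mono unfolding m_def[symmetric] by (simp add: power2_norm_eq_inner algebra_simps inner_commute)
  also have "\<dots> \<le> (m + c') * (norm u * norm u')"
    using m by (intro mult_left_mono norm_cauchy_schwarz) auto
  finally have "(norm u' - norm u) * (c' * norm u' - m * norm u) \<le> 0"
    by (simp add: algebra_simps power2_eq_square)
  then have "c' * norm u' \<le> m * norm u" using less by (simp add: mult_le_0_iff)
  also have "\<dots> \<le> c' * norm u" using m by (intro mult_right_mono) auto
  finally show False using less c by simp
qed

text \<open>
  Monotonicity against a fixed point \<open>(y, v)\<close> of the graph is, up to terms tending to zero, the
  linear inequality \<open>x k \<bullet> v \<le> y \<bullet> v\<close>. It is inherited by
  \<open>tail_core x\<close>, and maximality turns it into membership.
\<close>

lemma tail_core_subset_op_zeros: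
  assumes max: "maximally_monotone A"
    and u: "\<And>k. u k \<in> A (p k)" and u0: "u \<longlonglongrightarrow> 0"
    and diff: "(\<lambda>k. x k - p k) \<longlonglongrightarrow> 0" and bdd: "bounded (range x)"
  shows "tail_core x \<subseteq> op_zeros A"
proof
  fix q assume q: "q \<in> tail_core x"
  obtain B where B: "\<And>k. norm (x k) \<le> B" using bdd by (auto simp: bounded_iff)
  have "0 \<in> A q"
  proof (rule maximally_monotone_mem[OF max])
    fix y v assume yv: "v \<in> A y"
    have "(\<lambda>k. norm (u k) * (B + norm y) + norm (x k - p k) * (norm (u k) + norm v)) \<longlonglongrightarrow> norm (0::'a) * (B + norm y) + norm (0::'a) * (norm (0::'a) + norm v)"
      by (intro tendsto_intros u0 diff)
    then have lim: "(\<lambda>k. norm (u k) * (B + norm y) + norm (x k - p k) * (norm (u k) + norm v)) \<longlonglongrightarrow> 0" by simp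
    have bound: "x k \<bullet> v \<le> y \<bullet> v + (norm (u k) * (B + norm y) + norm (x k - p k) * (norm (u k) + norm v))" for k
    proof -
      have "0 \<le> (p k - y) \<bullet> (u k - v)"
        using max u yv by (auto simp: maximally_monotone_def monotone_operator_def)
      also have "\<dots> = y \<bullet> v - x k \<bullet> v + (u k \<bullet> (x k - y) + (x k - p k) \<bullet> (v - u k))"
        by (simp add: algebra_simps inner_commute)
      also have "\<dots> \<le> y \<bullet> v - x k \<bullet> v + (norm (u k) * (B + norm y) + norm (x k - p k) * (norm (u k) + norm v))"
      proof (intro add_left_mono add_mono)
        have "u k \<bullet> (x k - y) \<le> norm (u k) * norm (x k - y)" by (rule norm_cauchy_schwarz)
        also have "\<dots> \<le> norm (u k) * (B + norm y)"
          using norm_triangle_ineq4[of "x k" y] B[of k] by (intro mult_left_mono) auto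
        finally show "u k \<bullet> (x k - y) \<le> norm (u k) * (B + norm y)" .
        have "(x k - p k) \<bullet> (v - u k) \<le> norm (x k - p k) * norm (v - u k)" by (rule norm_cauchy_schwarz)
        also have "\<dots> \<le> norm (x k - p k) * (norm (u k) + norm v)"
          using norm_triangle_ineq4[of v "u k"] by (intro mult_left_mono) auto
        finally show "(x k - p k) \<bullet> (v - u k) \<le> norm (x k - p k) * (norm (u k) + norm v)" .
      qed
      finally show ?thesis by linarith
    qed
    have "q \<bullet> v \<le> y \<bullet> v"
    proof (rule field_le_epsilon)
      fix e :: real assume "0 < e"
      then have "eventually (\<lambda>k. x k \<bullet> v \<le> y \<bullet> v + e) sequentially"
        using order_tendstoD(2)[OF lim, of e]
        by (auto elim!: eventually_mono intro: order_trans[OF bound])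
      then show "q \<bullet> v \<le> y \<bullet> v + e" by (rule tail_core_le[OF q])
    qed
    then show "0 \<le> (q - y) \<bullet> (0 - v)" by (simp add: inner_diff_left)
  qed
  then show "q \<in> op_zeros A" by (simp add: op_zeros_def)
qed

text \<open>
  The conditions on the relaxation and step-size sequences in a form that is stable under dropping
  initial terms, as is needed to restart the iteration at an arbitrary time.
\<close>

definition admissible_parameters :: "(nat \<Rightarrow> real) \<Rightarrow> (nat \<Rightarrow> real) \<Rightarrow> bool"
  where "admissible_parameters lam c \<longleftrightarrow>
    (\<forall>k. 0 \<le> lam k \<and> lam k \<le> 2 \<and> 0 < c k) \<and>
    (filterlim (\<lambda>n. \<Sum>k<n. (c k)\<^sup>2) at_top sequentially \<and> (\<forall>k. lam k = 1) \<or>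
     filterlim (\<lambda>n. \<Sum>k<n. lam k * (2 - lam k)) at_top sequentially \<and>
     bdd_above (range c) \<and> (\<forall>k. c k \<le> c (Suc k)))"

lemma exact_iteration_converges_weakly:
  fixes A :: "'a::{real_inner, banach} \<Rightarrow> 'a set"
  assumes max: "maximally_monotone A" and ne: "op_zeros A \<noteq> {}"
    and adm: "admissible_parameters lam c"
    and x: "\<And>k. x (Suc k) = relaxed_resolvent A (lam k) (c k) (x k)"
  shows "\<exists>p\<in>op_zeros A. converges_weakly x p"
proof -
  have l0: "0 \<le> lam k" and l2: "lam k \<le> 2" and c0: "0 < c k" for k
    using adm by (auto simp: admissible_parameters_def)
  define p where "p k = resolvent (op_scale (c k) A) (x k)" for k
  define u where "u k = (1 / c k) *\<^sub>R (x k - p k)" for k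
  have uA: "u k \<in> A (p k)" for k
    unfolding u_def p_def by (rule resolvent_op_scale_mem[OF max c0])
  have xp: "x k - p k = c k *\<^sub>R u k" for k using c0[of k] by (simp add: u_def)
  have x_Suc: "x (Suc k) = (1 - lam k) *\<^sub>R x k + lam k *\<^sub>R p k" for k
    by (simp add: x relaxed_resolvent_def p_def)
  have mono: "0 \<le> (a - b) \<bullet> (v - w)" if "v \<in> A a" "w \<in> A b" for a b v w
    using max that by (auto simp: maximally_monotone_def monotone_operator_def)

  \<comment> \<open>Distances to zeros decrease, and the decrease controls the displacements \<open>x k - p k\<close>.\<close>
  have descent: "(norm (x (Suc k) - z))\<^sup>2
      \<le> (norm (x k - z))\<^sup>2 - lam k * (2 - lam k) * (norm (x k - p k))\<^sup>2" if z: "z \<in> op_zeros A" for k z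
  proof -
    have "0 \<le> (p k - z) \<bullet> (u k - 0)" using mono[OF uA[of k], of 0 z] z by (simp add: op_zeros_def)
    then have "0 \<le> (p k - z) \<bullet> (x k - p k)" using c0[of k] by (simp add: xp)
    then have "0 \<le> (p k - z) \<bullet> ((x k - z) - (p k - z))" by simp
    from relaxation_norm_le[OF this l0[of k]] show ?thesis
      by (simp add: x_Suc algebra_simps)
  qed
  have w0: "0 \<le> lam k * (2 - lam k)" for k using l0 l2 by simp
  have fejer: "norm (x (Suc k) - z) \<le> norm (x k - z)" if z: "z \<in> op_zeros A" for k z
  proof (rule power2_le_imp_le)
    have "0 \<le> lam k * (2 - lam k) * (norm (x k - p k))\<^sup>2" using w0[of k] by simp
    then show "(norm (x (Suc k) - z))\<^sup>2 \<le> (norm (x k - z))\<^sup>2" using descent[OF z, of k] by linarith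
  qed simp
  obtain z where z: "z \<in> op_zeros A" using ne by blast
  have sum_le: "(\<Sum>k<n. lam k * (2 - lam k) * (norm (x k - p k))\<^sup>2) \<le> (norm (x 0 - z))\<^sup>2" for n
  proof -
    have "(\<Sum>k<n. lam k * (2 - lam k) * (norm (x k - p k))\<^sup>2) \<le> (norm (x 0 - z))\<^sup>2 - (norm (x n - z))\<^sup>2"
    proof (induction n)
      case (Suc n)
      then show ?case using descent[OF z, of n] by simp
    qed simp
    then show ?thesis using zero_le_power2[of "norm (x n - z)"] by linarith
  qed
  have dec: "decseq (\<lambda>k. norm (x k - z))" if "z \<in> op_zeros A" for z
    using fejer[OF that] by (rule decseq_SucI)
  have conv: "convergent (\<lambda>k. norm (x k - z))" if "z \<in> op_zeros A" for z
    using decseq_convergent[OF dec[OF that], of 0] by (auto simp: convergent_def)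
  have bdd: "bounded (range x)"
  proof (rule boundedI, clarify)
    fix k
    have "norm (x k - z) \<le> norm (x 0 - z)" using decseqD[OF dec[OF z], of 0 k] by simp
    then show "norm (x k) \<le> norm (x 0 - z) + norm z" using norm_triangle_sub[of "x k" z] by linarith
  qed

  have u_dec: "norm (u (Suc k)) \<le> norm (u k)" for k
  proof (rule relaxed_resolvent_residual_antimono)
    have "x k - x (Suc k) = lam k *\<^sub>R (x k - p k)" by (simp add: x_Suc algebra_simps)
    then have "p (Suc k) - p k = (1 - lam k) *\<^sub>R (x k - p k) - (x (Suc k) - p (Suc k))"
      by (simp add: algebra_simps)
    then have "p (Suc k) - p k = ((1 - lam k) * c k) *\<^sub>R u k - c (Suc k) *\<^sub>R u (Suc k)" by (simp add: xp)
    then show "0 \<le> (((1 - lam k) * c k) *\<^sub>R u k - c (Suc k) *\<^sub>R u (Suc k)) \<bullet> (u (Suc k) - u k)"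
      using mono[OF uA uA] by metis
    show "lam k = 1 \<or> c k \<le> c (Suc k)" using adm by (auto simp: admissible_parameters_def)
  qed (use l0 l2 c0 in auto)
  have "(\<lambda>k. norm (u k)) \<longlonglongrightarrow> 0 \<and> (\<lambda>k. x k - p k) \<longlonglongrightarrow> 0"
    using adm unfolding admissible_parameters_def
  proof (elim conjE disjE)
    assume div: "filterlim (\<lambda>n. \<Sum>k<n. (c k)\<^sup>2) at_top sequentially" and l1: "\<forall>k. lam k = 1"
    \<comment> \<open>The same bound gives the weights \<open>(c k)\<^sup>2\<close> for the residuals and weight \<open>1\<close> for the displacements.\<close>
    have sum1: "(\<Sum>k<n. (norm (x k - p k))\<^sup>2) \<le> (norm (x 0 - z))\<^sup>2" for n
      using sum_le[of n] l1 by simp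
    then have "(\<lambda>k. norm (u k)) \<longlonglongrightarrow> 0"
      using u_dec by (intro antimono_tendsto_zero[OF div]) (auto simp: xp power_mult_distrib)
    moreover have "summable (\<lambda>k. (norm (x k - p k))\<^sup>2)"
      by (rule bounded_imp_summable[of _ "(norm (x 0 - z))\<^sup>2"])
        (use sum1[of "Suc _"] in \<open>auto simp: lessThan_Suc_atMost\<close>)
    then have "(\<lambda>k. sqrt ((norm (x k - p k))\<^sup>2)) \<longlonglongrightarrow> sqrt 0"
      by (intro tendsto_real_sqrt summable_LIMSEQ_zero)
    then have "(\<lambda>k. x k - p k) \<longlonglongrightarrow> 0" by (simp add: tendsto_norm_zero_iff)
    ultimately show ?thesis by blast
  next
    assume div: "filterlim (\<lambda>n. \<Sum>k<n. lam k * (2 - lam k)) at_top sequentially"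
      and cb: "bdd_above (range c)" and cS: "\<forall>k. c k \<le> c (Suc k)"
    have c_ge: "c 0 \<le> c k" for k using cS by (simp add: lift_Suc_mono_le)
    \<comment> \<open>The step sizes are at least \<open>c 0\<close>, so the summable displacements dominate the residuals.\<close>
    have u_lim: "(\<lambda>k. norm (u k)) \<longlonglongrightarrow> 0"
    proof (rule antimono_tendsto_zero[where a = "\<lambda>k. norm (u k)", OF div w0 norm_ge_zero u_dec])
      fix n
      have "(\<Sum>k<n. lam k * (2 - lam k) * (norm (u k))\<^sup>2) * (c 0)\<^sup>2
          \<le> (\<Sum>k<n. lam k * (2 - lam k) * (norm (x k - p k))\<^sup>2)"
        unfolding sum_distrib_right
      proof (rule sum_mono)
        fix k
        have "(norm (u k))\<^sup>2 * (c 0)\<^sup>2 \<le> (norm (u k))\<^sup>2 * (c k)\<^sup>2"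
          using c_ge[of k] c0[of 0] by (intro mult_left_mono power_mono) auto
        then have "lam k * (2 - lam k) * ((norm (u k))\<^sup>2 * (c 0)\<^sup>2) \<le> lam k * (2 - lam k) * (norm (x k - p k))\<^sup>2"
          using w0[of k] c0[of k] by (intro mult_left_mono) (simp_all add: xp power_mult_distrib mult.commute)
        then show "lam k * (2 - lam k) * (norm (u k))\<^sup>2 * (c 0)\<^sup>2 \<le> lam k * (2 - lam k) * (norm (x k - p k))\<^sup>2"
          by (simp add: mult.assoc)
      qed
      also have "\<dots> \<le> (norm (x 0 - z))\<^sup>2" by (rule sum_le)
      finally show "(\<Sum>k<n. lam k * (2 - lam k) * (norm (u k))\<^sup>2) \<le> (norm (x 0 - z))\<^sup>2 / (c 0)\<^sup>2"
        using c0[of 0] by (simp add: pos_le_divide_eq)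
    qed
    obtain b where b: "\<And>k. c k \<le> b" using cb by (auto simp: bdd_above_def)
    have "(\<lambda>k. x k - p k) \<longlonglongrightarrow> 0"
    proof (rule Lim_null_comparison)
      show "(\<lambda>k. b * norm (u k)) \<longlonglongrightarrow> 0" using tendsto_mult_right_zero[OF u_lim] by simp
      show "eventually (\<lambda>k. norm (x k - p k) \<le> b * norm (u k)) sequentially"
        using b c0 by (auto simp: xp abs_of_pos intro!: always_eventually mult_right_mono)
    qed
    then show ?thesis using u_lim by blast
  qed
  then have "tail_core x \<subseteq> op_zeros A"
    by (intro tail_core_subset_op_zeros[OF max uA _ _ bdd]) (auto simp: tendsto_norm_zero_iff)
  then show ?thesis by (intro Opial_tail_core bdd conv)
qed

section \<open>Summable perturbations of nonexpansive iterations\<close>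

primrec orbit :: "(nat \<Rightarrow> 'a \<Rightarrow> 'a) \<Rightarrow> 'a \<Rightarrow> nat \<Rightarrow> 'a"
  where "orbit R y 0 = y"
  | "orbit R y (Suc k) = R k (orbit R y k)"

lemma orbit_add: "orbit R y (m + k) = orbit (\<lambda>i. R (m + i)) (orbit R y m) k"
  by (induction k) auto

lemma orbit_nonexpansive:
  fixes y y' :: "'a::real_normed_vector"
  assumes "\<And>k a b. norm (R k a - R k b) \<le> norm (a - b)"
  shows "norm (orbit R y k - orbit R y' k) \<le> norm (y - y')"
  by (induction k) (auto intro: order_trans[OF assms])

lemma weak_limits_norm_le:
  assumes a: "converges_weakly a p" and b: "converges_weakly b q"
    and le: "\<And>k. norm (a k - b k) \<le> r"
  shows "norm (p - q) \<le> r"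
proof -
  have "(\<lambda>k. a k \<bullet> (p - q) - b k \<bullet> (p - q)) \<longlonglongrightarrow> p \<bullet> (p - q) - q \<bullet> (p - q)"
    using a b unfolding converges_weakly_def by (intro tendsto_diff) auto
  moreover have "a k \<bullet> (p - q) - b k \<bullet> (p - q) \<le> r * norm (p - q)" for k
  proof -
    have "(a k - b k) \<bullet> (p - q) \<le> norm (a k - b k) * norm (p - q)" by (rule norm_cauchy_schwarz)
    also have "\<dots> \<le> r * norm (p - q)" using le by (intro mult_right_mono) auto
    finally show ?thesis by (simp add: inner_diff_left)
  qed
  ultimately have "p \<bullet> (p - q) - q \<bullet> (p - q) \<le> r * norm (p - q)" by (intro LIMSEQ_le_const2) auto
  then have "norm (p - q) * norm (p - q) \<le> r * norm (p - q)"
    by (simp add: inner_diff_left power2_norm_eq_inner flip: power2_eq_square)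
  moreover have "0 \<le> r" using le[of 0] norm_ge_zero order_trans by blast
  ultimately show ?thesis by (cases "p = q") auto
qed

lemma converges_weakly_tail:
  assumes "converges_weakly x p"
  shows "converges_weakly (\<lambda>k. x (n + k)) p"
  unfolding converges_weakly_def
proof
  fix y
  have "(\<lambda>k. x (k + n) \<bullet> y) \<longlonglongrightarrow> p \<bullet> y"
    using assms by (intro LIMSEQ_ignore_initial_segment) (simp add: converges_weakly_def)
  then show "(\<lambda>k. x (n + k) \<bullet> y) \<longlonglongrightarrow> p \<bullet> y" by (simp add: add.commute)
qed

text \<open>
  \<open>S n\<close> is the error-free continuation of the perturbed sequence from time \<open>n\<close>, and
  \<open>r n\<close> bounds the error made from then on. The continuations from times \<open>n \<le> m\<close> follow the
  same maps after time \<open>m\<close>, so they remain as close as they were then, namely within \<open>r n\<close>, and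
  so do their weak limits.
\<close>

lemma perturbed_orbit_converges_weakly:
  fixes R :: "nat \<Rightarrow> 'a::{real_inner, banach} \<Rightarrow> 'a"
  assumes nonexp: "\<And>k a b. norm (R k a - R k b) \<le> norm (a - b)"
    and exact: "\<And>n y. \<exists>p\<in>C. converges_weakly (orbit (\<lambda>k. R (n + k)) y) p"
    and C: "closed C"
    and x: "\<And>k. x (Suc k) = R k (x k) + f k"
    and f: "summable (\<lambda>k. norm (f k))"
  shows "\<exists>p\<in>C. converges_weakly x p"
proof -
  define r where "r n = (\<Sum>k. norm (f (k + n)))" for n
  define S where "S n = orbit (\<lambda>k. R (n + k)) (x n)" for n
  have r0: "r \<longlonglongrightarrow> 0" unfolding r_def by (rule suminf_exist_split2[OF f])
  have close: "norm (x (n + k) - S n k) \<le> r n" for n k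
  proof -
    have "norm (x (n + k) - S n k) \<le> (\<Sum>i<k. norm (f (i + n)))"
    proof (induction k)
      case (Suc k)
      have "norm (x (n + Suc k) - S n (Suc k))
          = norm ((R (n + k) (x (n + k)) - R (n + k) (S n k)) + f (n + k))"
        by (simp add: x S_def algebra_simps)
      also have "\<dots> \<le> norm (x (n + k) - S n k) + norm (f (n + k))"
        by (intro norm_triangle_le add_mono nonexp) simp
      finally show ?case using Suc by (simp add: add.commute)
    qed (simp add: S_def)
    also have "\<dots> \<le> r n" unfolding r_def
      by (intro sum_le_suminf summable_ignore_initial_segment[OF f]) auto
    finally show ?thesis .
  qed
  have "\<forall>n. \<exists>p. p \<in> C \<and> converges_weakly (S n) p"
    using exact unfolding S_def by blast
  then obtain z where "\<forall>n. z n \<in> C \<and> converges_weakly (S n) (z n)" by (rule choice[THEN exE])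
  then have zC: "\<And>n. z n \<in> C" and z: "\<And>n. converges_weakly (S n) (z n)" by auto
  have zz: "norm (z m - z n) \<le> r n" if nm: "n \<le> m" for m n
  proof -
    obtain d where d: "m = n + d" using nm le_Suc_ex by blast
    have lim: "converges_weakly (\<lambda>k. S n (d + k)) (z n)"
      by (rule converges_weakly_tail[OF z])
    have "S n (d + k) = orbit (\<lambda>k. R (m + k)) (S n d) k" for k
      by (simp add: S_def orbit_add d add.assoc)
    then have "norm (S m k - S n (d + k)) \<le> norm (x m - S n d)" for k
      unfolding S_def[of m] by (simp add: orbit_nonexpansive nonexp)
    also have "norm (x m - S n d) \<le> r n" unfolding d by (rule close)
    finally show ?thesis by (rule weak_limits_norm_le[OF z lim])
  qed
  obtain p where p: "z \<longlonglongrightarrow> p"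
  proof (rule convergent_if_dist_square_le)
    show "(\<lambda>n. (r n)\<^sup>2) \<longlonglongrightarrow> 0" using tendsto_power[OF r0, of 2] by simp
    show "(norm (z m - z n))\<^sup>2 \<le> (r n)\<^sup>2" if "n \<le> m" for m n
      using zz[OF that] by (intro power_mono) auto
  qed
  have pC: "p \<in> C" by (rule closed_sequentially[OF C zC p])
  have "converges_weakly x p"
  proof (rule converges_weaklyI)
    fix y :: 'a and e :: real assume e: "0 < e"
    have "(\<lambda>n. r n * norm y + z n \<bullet> y) \<longlonglongrightarrow> 0 * norm y + p \<bullet> y"
      by (intro tendsto_intros r0 p)
    then have "eventually (\<lambda>n. r n * norm y + z n \<bullet> y < p \<bullet> y + e) sequentially"
      using e by (intro order_tendstoD(2)) auto
    then obtain n where n: "r n * norm y + z n \<bullet> y < p \<bullet> y + e" by (auto simp: eventually_sequentially)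
    have "eventually (\<lambda>k. S n k \<bullet> y < p \<bullet> y + e - r n * norm y) sequentially"
      using z[of n] n unfolding converges_weakly_def by (intro order_tendstoD(2)[where y="z n \<bullet> y"]) auto
    then obtain N where N: "\<And>k. N \<le> k \<Longrightarrow> S n k \<bullet> y < p \<bullet> y + e - r n * norm y"
      by (auto simp: eventually_sequentially)
    have "x k \<bullet> y < p \<bullet> y + e" if k: "n + N \<le> k" for k
    proof -
      obtain j where j: "k = n + j" "N \<le> j" using k by (metis le_Suc_ex add.assoc le_add1)
      have "(x k - S n j) \<bullet> y \<le> norm (x k - S n j) * norm y" by (rule norm_cauchy_schwarz)
      also have "\<dots> \<le> r n * norm y" using close[of n j] j by (intro mult_right_mono) auto
      finally show ?thesis using N[OF j(2)] by (simp add: inner_diff_left)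
    qed
    then show "eventually (\<lambda>k. x k \<bullet> y < p \<bullet> y + e) sequentially"
      unfolding eventually_sequentially by blast
  qed
  then show ?thesis using pC by blast
qed

section \<open>The perturbed proximal point algorithm\<close>

lemma closed_op_zeros:
  assumes max: "maximally_monotone A"
  shows "closed (op_zeros A)"
proof -
  have eq: "op_zeros A = (\<Inter>(y, v)\<in>op_graph A. {x. v \<bullet> x \<le> v \<bullet> y})"
  proof (intro equalityI subsetI)
    fix x assume "x \<in> op_zeros A"
    then have "0 \<le> (x - y) \<bullet> (0 - v)" if "v \<in> A y" for y v
      using max that unfolding op_zeros_def maximally_monotone_def monotone_operator_def by blast
    then have "v \<bullet> x \<le> v \<bullet> y" if "v \<in> A y" for y v
      using that by (simp add: inner_diff_left inner_commute[of v])
    then show "x \<in> (\<Inter>(y, v)\<in>op_graph A. {x. v \<bullet> x \<le> v \<bullet> y})"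
      by (auto simp: op_graph_def)
  next
    fix x assume x: "x \<in> (\<Inter>(y, v)\<in>op_graph A. {x. v \<bullet> x \<le> v \<bullet> y})"
    have "0 \<in> A x"
    proof (rule maximally_monotone_mem[OF max])
      fix y v assume "v \<in> A y"
      then have "v \<bullet> x \<le> v \<bullet> y" using x by (auto simp: op_graph_def)
      then show "0 \<le> (x - y) \<bullet> (0 - v)" by (simp add: inner_diff_left inner_commute[of v])
    qed
    then show "x \<in> op_zeros A" by (simp add: op_zeros_def)
  qed
  show ?thesis unfolding eq by (intro closed_INT) (auto intro: closed_halfspace_le)
qed

lemma filterlim_sum_shift:
  fixes w :: "nat \<Rightarrow> real"
  assumes "filterlim (\<lambda>n. \<Sum>k<n. w k) at_top sequentially"
  shows "filterlim (\<lambda>n. \<Sum>k<n. w (m + k)) at_top sequentially"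
proof -
  have "filterlim (\<lambda>n. \<Sum>k<n + m. w k) at_top sequentially"
    using assms by (rule filterlim_compose) (rule filterlim_add_const_nat_at_top)
  then have "filterlim (\<lambda>n. - (\<Sum>k<m. w k) + (\<Sum>k<n + m. w k)) at_top sequentially"
    by (rule filterlim_tendsto_add_at_top[OF tendsto_const])
  moreover have "- (\<Sum>k<m. w k) + (\<Sum>k<n + m. w k) = (\<Sum>k<n. w (m + k))" for n
    by (induction n) (auto simp: add.commute)
  ultimately show ?thesis by simp
qed

lemma admissible_parameters_shift:
  assumes "admissible_parameters lam c"
  shows "admissible_parameters (\<lambda>k. lam (n + k)) (\<lambda>k. c (n + k))"
proof -
  have "bdd_above (range c) \<Longrightarrow> bdd_above (range (\<lambda>k. c (n + k)))"
    by (erule bdd_above_mono) auto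
  then show ?thesis using assms unfolding admissible_parameters_def
    using filterlim_sum_shift[of "\<lambda>k. (c k)\<^sup>2" n] filterlim_sum_shift[of "\<lambda>k. lam k * (2 - lam k)" n]
    by auto
qed

theorem theorem5p8:
  fixes A :: "'a::{real_inner, banach} \<Rightarrow> 'a set"
    and x e :: "nat \<Rightarrow> 'a"
    and x0 :: 'a
    and lam c eta :: "nat \<Rightarrow> real"
  assumes "maximally_monotone A"
    and "op_zeros A \<noteq> {}"
    and "\<And>k. 0 \<le> lam k \<and> lam k \<le> 2"
    and "\<And>k. 0 < c k"
    and "\<And>k. 0 \<le> eta k"
    and "x 0 = x0"
    and "\<And>k. x (Suc k) =
           (1 - lam k) *\<^sub>R x k + lam k *\<^sub>R resolvent (op_scale (c k) A) (x k) + eta k *\<^sub>R e k"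
    and "summable (\<lambda>k. eta k * norm (e k))"
    and "(filterlim (\<lambda>n. \<Sum>k<n. (c k)\<^sup>2) at_top sequentially \<and> (\<forall>k. lam k = 1)) \<or>
         (filterlim (\<lambda>n. \<Sum>k<n. lam k * (2 - lam k)) at_top sequentially \<and>
          bdd_above (range c) \<and>
          (\<forall>k. 0 < lam k \<and> lam k \<le> 2 \<and> c k \<le> c (Suc k)))"
  shows "\<exists>p\<in>op_zeros A. converges_weakly x p"
proof (rule perturbed_orbit_converges_weakly)
  have adm: "admissible_parameters lam c"
    using assms(3,4,9) by (auto simp: admissible_parameters_def)
  show "norm (relaxed_resolvent A (lam k) (c k) a - relaxed_resolvent A (lam k) (c k) b) \<le> norm (a - b)" for k a b
    using assms(3,4) by (intro relaxed_resolvent_nonexpansive[OF assms(1)]) auto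
  show "\<exists>p\<in>op_zeros A. converges_weakly (orbit (\<lambda>k. relaxed_resolvent A (lam (n + k)) (c (n + k))) y) p" for n y
    by (rule exact_iteration_converges_weakly[OF assms(1,2) admissible_parameters_shift[OF adm, of n]]) simp
  show "closed (op_zeros A)" by (rule closed_op_zeros[OF assms(1)])
  show "x (Suc k) = relaxed_resolvent A (lam k) (c k) (x k) + eta k *\<^sub>R e k" for k
    by (simp add: assms(7) relaxed_resolvent_def)
  show "summable (\<lambda>k. norm (eta k *\<^sub>R e k))" using assms(5,8) by simp
qed

end
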